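(* Let $B$ be a finite skew left brace with $\mathrm{Pb}(B)=\frac{5}{8}$. Then both the additive group and the multiplicative group of the quotient skew brace $B/\mathrm{Ann}(B)$ are isomorphic to $\mathbb{Z}/2\mathbb{Z}\times\mathbb{Z}/2\mathbb{Z}$.
   Context: A skew left brace is a set $B$ with two group structures, the additive group $(B,+)$ and the multiplicative group $(B,\circ)$ (neither assumed abelian), such that $a\circ(b+c)=(a\circ b)-a+(a\circ c)$ for all $a,b,c\in B$, where $-a$ is the inverse of $a$ in $(B,+)$. The identities of the two groups coincide and are denoted by $1$. Put $a*b:=-a+(a\circ b)-b$ and $[a,b]^+:=a+b-a-b$. The annihilator of $B$ is $\mathrm{Ann}(B):=\{a\in B\mid a+b=b+a=a\circ b=b\circ a \text{ for all } b\in B\}$; it is an ideal of $B$, so $B/\mathrm{Ann}(B)$ is a quotient skew brace. For a finite skew left brace $B$, the commuting probability is $$\mathrm{Pb}(B):=\frac{1}{|B|^2}\,\bigl|\{(a,b)\in B\times B \mid a*b=b*a=[a,b]^+=1\}\bigr|.$$ *)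

theory Defs
  imports Complex_Main "HOL-Algebra.QuotRing" "HOL-Algebra.Elementary_Groups"
begin

text \<open>
  A skew left brace is carried by a HOL-Algebra ring record: \<open>\<oplus>\<close> is the additive operation, \<open>\<otimes>\<close>
  is the operation \<open>\<circ>\<close>, so its additive group is \<open>add_monoid B\<close> and its multiplicative
  group is \<open>B\<close> itself, viewed as a monoid record. No ring axiom is assumed; in particular
  neither group is assumed abelian.
\<close>

locale skew_left_brace =
  fixes B :: "('a, 'm) ring_scheme" (structure)
  assumes add_group: "group (add_monoid B)"
    and mult_group: "group B"
    and brace_distrib:
      "\<lbrakk>a \<in> carrier B; b \<in> carrier B; c \<in> carrier B\<rbrakk> \<Longrightarrow>
        a \<otimes> (b \<oplus> c) = ((a \<otimes> b) \<ominus> a) \<oplus> (a \<otimes> c)"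

lemma (in skew_left_brace) zero_eq_one: "\<zero> = \<one>"
proof -
  interpret A: group "add_monoid B" by (rule add_group)
  interpret M: group B by (rule mult_group)
  have z: "\<zero> \<in> carrier B" using A.one_closed by simp
  have cl: "\<And>x y. x \<in> carrier B \<Longrightarrow> y \<in> carrier B \<Longrightarrow> x \<oplus> y \<in> carrier B"
    using A.m_closed by simp
  have zz: "\<zero> \<oplus> \<zero> = \<zero>" using A.l_one[of \<zero>] z by simp
  have "\<one> \<otimes> (\<zero> \<oplus> \<zero>) = ((\<one> \<otimes> \<zero>) \<ominus> \<one>) \<oplus> (\<one> \<otimes> \<zero>)"
    using z by (intro brace_distrib) auto
  hence "\<zero> = (\<zero> \<oplus> (\<ominus> \<one>)) \<oplus> \<zero>" using z zz by (simp add: a_minus_def)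
  hence "\<zero> = \<ominus> \<one>"
    using A.l_one[of "\<ominus> \<one>"] A.r_one[of "\<ominus> \<one>"] A.inv_closed[of \<one>] z
    by (simp add: a_inv_def)
  thus ?thesis using A.inv_inv[of \<one>] A.inv_one by (simp add: a_inv_def)
qed

definition brace_star :: "('a, 'm) ring_scheme \<Rightarrow> 'a \<Rightarrow> 'a \<Rightarrow> 'a" where
  "brace_star B a b = ((\<ominus>\<^bsub>B\<^esub> a) \<oplus>\<^bsub>B\<^esub> (a \<otimes>\<^bsub>B\<^esub> b)) \<ominus>\<^bsub>B\<^esub> b"

definition add_commutator :: "('a, 'm) ring_scheme \<Rightarrow> 'a \<Rightarrow> 'a \<Rightarrow> 'a" where
  "add_commutator B a b = ((a \<oplus>\<^bsub>B\<^esub> b) \<ominus>\<^bsub>B\<^esub> a) \<ominus>\<^bsub>B\<^esub> b"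

definition brace_annihilator :: "('a, 'm) ring_scheme \<Rightarrow> 'a set" where
  "brace_annihilator B =
    {a \<in> carrier B. \<forall>b \<in> carrier B.
      a \<oplus>\<^bsub>B\<^esub> b = b \<oplus>\<^bsub>B\<^esub> a \<and> b \<oplus>\<^bsub>B\<^esub> a = a \<otimes>\<^bsub>B\<^esub> b \<and> a \<otimes>\<^bsub>B\<^esub> b = b \<otimes>\<^bsub>B\<^esub> a}"

text \<open>The common identity of the two groups is written \<open>\<zero>\<close> here; see \<open>zero_eq_one\<close>.\<close>

definition commuting_probability :: "('a, 'm) ring_scheme \<Rightarrow> real" where
  "commuting_probability B =
    real (card {(a, b). a \<in> carrier B \<and> b \<in> carrier B \<and>
      brace_star B a b = \<zero>\<^bsub>B\<^esub> \<and> brace_star B b a = \<zero>\<^bsub>B\<^esub> \<and> add_commutator B a b = \<zero>\<^bsub>B\<^esub>})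
    / (real (card (carrier B)))\<^sup>2"

text \<open>
  The library quotient \<open>B Quot I\<close> only uses the record operations: its elements are the additive
  cosets \<open>I +> a\<close>, its sum is the sum of cosets, and its product sends \<open>I +> a\<close>, \<open>I +> b\<close> to
  \<open>I +> (a \<otimes> b)\<close>. The lemmas below check that for the annihilator \<open>I\<close> of a skew left brace both
  operations are well defined on cosets and yield a skew left brace.
\<close>

context skew_left_brace
begin

interpretation A: group "add_monoid B"
  rewrites "carrier (add_monoid B) = carrier B"
    and "monoid.mult (add_monoid B) = (\<oplus>)"
    and "monoid.one (add_monoid B) = \<zero>"
    and "m_inv (add_monoid B) = a_inv B"
  by (simp_all add: add_group a_inv_def)

interpretation M: group B by (rule mult_group)

lemma annihilatorD:
  assumes "a \<in> brace_annihilator B" "b \<in> carrier B"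
  shows "a \<in> carrier B" "b \<oplus> a = a \<oplus> b" "a \<otimes> b = a \<oplus> b" "b \<otimes> a = a \<oplus> b"
  using assms by (auto simp: brace_annihilator_def)

lemma annihilatorI:
  assumes "a \<in> carrier B"
    "\<And>b. b \<in> carrier B \<Longrightarrow> b \<oplus> a = a \<oplus> b"
    "\<And>b. b \<in> carrier B \<Longrightarrow> a \<otimes> b = a \<oplus> b"
    "\<And>b. b \<in> carrier B \<Longrightarrow> b \<otimes> a = a \<oplus> b"
  shows "a \<in> brace_annihilator B"
  using assms by (auto simp: brace_annihilator_def)

lemma annihilator_add_subgroup: "subgroup (brace_annihilator B) (add_monoid B)"
proof (rule group.subgroupI[OF add_group])
  let ?I = "brace_annihilator B"
  show "?I \<subseteq> carrier (add_monoid B)" by (auto simp: brace_annihilator_def)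
  have "\<zero> \<in> ?I"
    by (rule annihilatorI) (auto simp: zero_eq_one[symmetric] M.l_one[folded zero_eq_one]
      M.r_one[folded zero_eq_one])
  thus "?I \<noteq> {}" by auto
  fix a assume a: "a \<in> ?I"
  hence ac: "a \<in> carrier B" by (auto simp: brace_annihilator_def)
  have comm: "b \<oplus> (\<ominus> a) = (\<ominus> a) \<oplus> b" if "b \<in> carrier B" for b
  proof -
    have "((\<ominus> a) \<oplus> b) \<oplus> a = (\<ominus> a) \<oplus> (a \<oplus> b)"
      using annihilatorD(2)[OF a that] that ac by (simp add: A.m_assoc)
    also have "\<dots> = b" using that ac by (simp add: A.m_assoc[symmetric])
    finally show ?thesis using A.inv_solve_right[of "(\<ominus> a) \<oplus> b" b a] that ac by simp
  qed
  have e1: "a \<otimes> ((\<ominus> a) \<oplus> b) = b" if "b \<in> carrier B" for b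
    using that ac annihilatorD(3)[OF a, of "(\<ominus> a) \<oplus> b"] by (simp add: A.m_assoc[symmetric])
  have "a \<otimes> (\<ominus> a) = \<one>" using e1[of \<zero>] ac by (simp add: zero_eq_one[symmetric])
  hence i: "inv a = \<ominus> a" using ac by (metis M.inv_equality M.inv_inv M.inv_closed A.inv_closed)
  have l: "(\<ominus> a) \<otimes> b = (\<ominus> a) \<oplus> b" if "b \<in> carrier B" for b
    using e1[OF that] ac that i by (metis A.inv_closed A.m_closed M.inv_solve_left)
  have e2: "((\<ominus> a) \<oplus> b) \<otimes> a = b" if "b \<in> carrier B" for b
    using that ac annihilatorD(4)[OF a, of "(\<ominus> a) \<oplus> b"] by (simp add: A.m_assoc[symmetric])
  have r: "b \<otimes> (\<ominus> a) = (\<ominus> a) \<oplus> b" if "b \<in> carrier B" for b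
    using e2[OF that] ac that i by (metis A.inv_closed A.m_closed M.inv_solve_right)
  have "\<ominus> a \<in> ?I" using ac comm l r by (intro annihilatorI) auto
  thus "inv\<^bsub>add_monoid B\<^esub> a \<in> ?I" by (simp add: a_inv_def)
  fix b assume b: "b \<in> ?I"
  hence bc: "b \<in> carrier B" by (auto simp: brace_annihilator_def)
  have "a \<oplus> b \<in> ?I"
  proof (rule annihilatorI)
    fix c assume c: "c \<in> carrier B"
    show "c \<oplus> (a \<oplus> b) = (a \<oplus> b) \<oplus> c"
      using annihilatorD[OF a] annihilatorD[OF b] ac bc c by (metis A.m_assoc)
    show "(a \<oplus> b) \<otimes> c = (a \<oplus> b) \<oplus> c"
      using annihilatorD[OF a] annihilatorD[OF b] ac bc c
      by (metis A.m_assoc M.m_assoc A.m_closed)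
    show "c \<otimes> (a \<oplus> b) = (a \<oplus> b) \<oplus> c"
      using annihilatorD[OF a] annihilatorD[OF b] ac bc c
      by (metis A.m_assoc M.m_assoc A.m_closed)
  qed (use ac bc in auto)
  thus "a \<otimes>\<^bsub>add_monoid B\<^esub> b \<in> ?I" by simp
qed

lemma annihilator_normal: "brace_annihilator B \<lhd> add_monoid B"
proof -
  have "brace_annihilator B #>\<^bsub>add_monoid B\<^esub> x = x <#\<^bsub>add_monoid B\<^esub> brace_annihilator B"
    if "x \<in> carrier B" for x
    using annihilatorD(2)[OF _ that] by (auto simp: r_coset_def l_coset_def)
  thus ?thesis by (intro A.normalI annihilator_add_subgroup) auto
qed

lemma annihilator_coset_iff:
  assumes "x \<in> carrier B"
  shows "y \<in> brace_annihilator B +> x \<longleftrightarrow> (\<exists>i \<in> brace_annihilator B. y = i \<oplus> x)"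
  by (auto simp: a_r_coset_def r_coset_def)

lemma quot_add:
  assumes "x \<in> carrier B" "y \<in> carrier B"
  shows "(brace_annihilator B +> x) \<oplus>\<^bsub>B Quot brace_annihilator B\<^esub> (brace_annihilator B +> y)
    = brace_annihilator B +> (x \<oplus> y)"
  using normal.rcos_sum[OF annihilator_normal, of x y] assms
  by (simp add: FactRing_def set_add_def a_r_coset_def)

lemma annihilator_coset_eq:
  assumes "i \<in> brace_annihilator B" "x \<in> carrier B"
  shows "brace_annihilator B +> (i \<oplus> x) = brace_annihilator B +> x"
  using A.repr_independence[of "i \<oplus> x" "brace_annihilator B" x] assms annihilator_add_subgroup
  by (auto simp: a_r_coset_def r_coset_def)

lemma quot_mult:
  assumes x: "x \<in> carrier B" and y: "y \<in> carrier B"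
  shows "(brace_annihilator B +> x) \<otimes>\<^bsub>B Quot brace_annihilator B\<^esub> (brace_annihilator B +> y)
    = brace_annihilator B +> (x \<otimes> y)"
proof -
  let ?I = "brace_annihilator B"
  have step: "?I +> ((i \<oplus> x) \<otimes> (j \<oplus> y)) = ?I +> (x \<otimes> y)" if i: "i \<in> ?I" and j: "j \<in> ?I" for i j
  proof -
    have ic: "i \<in> carrier B" and jc: "j \<in> carrier B"
      using i j by (auto simp: brace_annihilator_def)
    have "(i \<oplus> x) \<otimes> (j \<oplus> y) = i \<otimes> x \<otimes> (y \<otimes> j)"
      using annihilatorD(3)[OF i x] annihilatorD(4)[OF j y] by simp
    also have "\<dots> = i \<otimes> ((x \<otimes> y) \<otimes> j)" using ic jc x y by (simp add: M.m_assoc)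
    also have "\<dots> = i \<oplus> (j \<oplus> (x \<otimes> y))"
      using annihilatorD(4)[OF j, of "x \<otimes> y"] annihilatorD(3)[OF i, of "j \<oplus> (x \<otimes> y)"] x y jc
      by simp
    finally show ?thesis
      using annihilator_coset_eq i j x y jc by simp
  qed
  have "\<zero> \<in> ?I" using subgroup.one_closed[OF annihilator_add_subgroup] by simp
  hence "x \<in> ?I +> x" "y \<in> ?I +> y"
    using x y by (auto simp: annihilator_coset_iff intro: bexI[of _ \<zero>])
  moreover have "?I +> (a \<otimes> b) = ?I +> (x \<otimes> y)" if "a \<in> ?I +> x" "b \<in> ?I +> y" for a b
    using that step x y by (auto simp: annihilator_coset_iff)
  ultimately have "(\<Union>a \<in> ?I +> x. \<Union>b \<in> ?I +> y. ?I +> (a \<otimes> b)) = ?I +> (x \<otimes> y)"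
    by blast
  thus ?thesis by (simp add: FactRing_def rcoset_mult_def)
qed

lemma quot_carrier: "carrier (B Quot brace_annihilator B) = (\<lambda>x. brace_annihilator B +> x) ` carrier B"
  by (auto simp: FactRing_def A_RCOSETS_def RCOSETS_def a_r_coset_def)

lemma quot_add_group: "group (add_monoid (B Quot brace_annihilator B))"
  using normal.factorgroup_is_group[OF annihilator_normal]
  by (simp add: FactRing_def FactGroup_def A_RCOSETS_def set_add_def)

lemma quot_mult_group: "group (B Quot brace_annihilator B)"
proof (rule groupI)
  let ?I = "brace_annihilator B"
  let ?Q = "B Quot ?I"
  have one: "\<one>\<^bsub>?Q\<^esub> = ?I +> \<one>" by (simp add: FactRing_def)
  show "\<one>\<^bsub>?Q\<^esub> \<in> carrier ?Q" by (auto simp: one quot_carrier)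
  fix X assume "X \<in> carrier ?Q"
  then obtain x where x: "x \<in> carrier B" "X = ?I +> x" by (auto simp: quot_carrier)
  show "\<one>\<^bsub>?Q\<^esub> \<otimes>\<^bsub>?Q\<^esub> X = X" using x by (simp add: one quot_mult)
  have "(?I +> inv x) \<otimes>\<^bsub>?Q\<^esub> X = \<one>\<^bsub>?Q\<^esub>" using x by (simp add: one quot_mult)
  thus "\<exists>Y \<in> carrier ?Q. Y \<otimes>\<^bsub>?Q\<^esub> X = \<one>\<^bsub>?Q\<^esub>" using x by (auto simp: quot_carrier)
next
  fix X Y assume "X \<in> carrier (B Quot brace_annihilator B)" "Y \<in> carrier (B Quot brace_annihilator B)"
  thus "X \<otimes>\<^bsub>B Quot brace_annihilator B\<^esub> Y \<in> carrier (B Quot brace_annihilator B)"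
    by (auto simp: quot_carrier quot_mult)
next
  fix X Y Z
  assume "X \<in> carrier (B Quot brace_annihilator B)" "Y \<in> carrier (B Quot brace_annihilator B)"
    "Z \<in> carrier (B Quot brace_annihilator B)"
  thus "X \<otimes>\<^bsub>B Quot brace_annihilator B\<^esub> Y \<otimes>\<^bsub>B Quot brace_annihilator B\<^esub> Z =
    X \<otimes>\<^bsub>B Quot brace_annihilator B\<^esub> (Y \<otimes>\<^bsub>B Quot brace_annihilator B\<^esub> Z)"
    by (auto simp: quot_carrier quot_mult M.m_assoc)
qed

lemma quot_skew_left_brace: "skew_left_brace (B Quot brace_annihilator B)"
proof (rule skew_left_brace.intro[OF quot_add_group quot_mult_group])
  let ?I = "brace_annihilator B"
  let ?Q = "B Quot ?I"
  interpret Q: group "add_monoid ?Q" by (rule quot_add_group)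
  have minus: "\<ominus>\<^bsub>?Q\<^esub> (?I +> x) = ?I +> (\<ominus> x)" if x: "x \<in> carrier B" for x
  proof -
    have "(?I +> (\<ominus> x)) \<oplus>\<^bsub>?Q\<^esub> (?I +> x) = ?I +> \<zero>" using x by (simp add: quot_add)
    moreover have "\<zero>\<^bsub>?Q\<^esub> = ?I +> \<zero>"
      using A.coset_mult_one[of ?I] by (auto simp: FactRing_def a_r_coset_def brace_annihilator_def)
    ultimately have "inv\<^bsub>add_monoid ?Q\<^esub> (?I +> x) = ?I +> (\<ominus> x)"
      using x by (intro Q.inv_equality) (auto simp: quot_carrier)
    thus ?thesis by (simp add: a_inv_def)
  qed
  fix X Y Z assume "X \<in> carrier ?Q" "Y \<in> carrier ?Q" "Z \<in> carrier ?Q"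
  then obtain x y z where "x \<in> carrier B" "y \<in> carrier B" "z \<in> carrier B"
    "X = ?I +> x" "Y = ?I +> y" "Z = ?I +> z" by (auto simp: quot_carrier)
  thus "X \<otimes>\<^bsub>?Q\<^esub> (Y \<oplus>\<^bsub>?Q\<^esub> Z) = ((X \<otimes>\<^bsub>?Q\<^esub> Y) \<ominus>\<^bsub>?Q\<^esub> X) \<oplus>\<^bsub>?Q\<^esub> (X \<otimes>\<^bsub>?Q\<^esub> Z)"
    by (simp add: quot_add quot_mult minus a_minus_def brace_distrib)
qed

end

end

theory Submission
  imports Defs "HOL-Algebra.Multiplicative_Group"
begin

text \<open>
  Call \<open>a\<close> and \<open>b\<close> commuting if \<open>a \<oplus> b\<close>, \<open>b \<oplus> a\<close>, \<open>a \<otimes> b\<close> and \<open>b \<otimes> a\<close> all agree. This relation is symmetric,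
  but it need not be reflexive: it says \<open>a \<otimes> a = a \<oplus> a\<close> on the diagonal. The elements commuting with a
  fixed \<open>a\<close> form a subgroup \<open>C(a)\<close> of the multiplicative group (\<open>centralizer_subgroup\<close>), and the
  annihilator \<open>Z\<close> is the set of those \<open>a\<close> with \<open>C(a) = B\<close>. The commuting probability is the sum of
  all \<open>|C(a)|\<close> divided by \<open>|B|\<^sup>2\<close>.

  Off \<open>Z\<close>, \<open>|C(a)|\<close> is a proper divisor of \<open>|B|\<close> and a multiple of \<open>|Z|\<close>. Bounding it by
  \<open>|B| / 2\<close> gives \<open>5 / 8 \<le> 1 / 2 + |Z| / (2 |B|)\<close>, so \<open>Z\<close> has index at most 4. Indices 1, 2, 3
  determine every \<open>|C(a)|\<close> and give the probabilities 1, 3/4, 5/9. Hence the index is 4, the bound is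
  attained, and \<open>|C(a)| = 2 |Z|\<close> for every \<open>a\<close> outside \<open>Z\<close> (\<open>five_eighths_count\<close>). So each nontrivial
  class of \<open>B/Z\<close> commutes with exactly one nontrivial class, its partner, and this partnership is an
  involution; a class may be its own partner.

  Being the nontrivial element of a subgroup \<open>C(c)/Z\<close> of order 2, each nontrivial class has
  multiplicative order 2, which settles the multiplicative group (\<open>five_eighths_mult_square\<close>).
  For the additive group let \<open>a\<close> have partner \<open>c\<close>. If they are the same class, then
  \<open>a \<oplus> a = a \<otimes> a\<close>, which lies in \<open>Z\<close>. Otherwise \<open>d = a \<oplus> c = a \<otimes> c\<close> is the third nontrivial class, which
  must be its own partner, so \<open>d \<oplus> d\<close> vanishes modulo \<open>Z\<close>. In a cyclic group of order 4 the element
  \<open>d\<close> of order 2 is not the sum of the two generators, so \<open>a \<oplus> a\<close> vanishes modulo \<open>Z\<close> as well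
  (\<open>order_four_square_eq_one\<close>, \<open>five_eighths_add_square\<close>).
\<close>

section \<open>Groups of order four\<close>

lemma (in group) exponent_two_commute:
  assumes "\<And>x. x \<in> carrier G \<Longrightarrow> x \<otimes> x = \<one>" "x \<in> carrier G" "y \<in> carrier G"
  shows "x \<otimes> y = y \<otimes> x"
proof -
  have i: "inv u = u" if "u \<in> carrier G" for u
    using assms(1)[OF that] that by (simp add: inv_equality)
  show ?thesis using i assms(2,3) by (metis inv_mult_group m_closed)
qed

lemma (in group) order_four_exponent_two_iso:
  assumes card: "card (carrier G) = 4"
    and sq: "\<And>x. x \<in> carrier G \<Longrightarrow> x \<otimes> x = \<one>"
  shows "G \<cong> integer_mod_group 2 \<times>\<times> integer_mod_group 2"
proof -
  let ?V = "integer_mod_group 2 \<times>\<times> integer_mod_group 2"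
  have fin: "finite (carrier G)" using card by (metis card.infinite zero_neq_numeral)
  have c2: "carrier (integer_mod_group 2) = {0, 1}"
    by (auto simp: carrier_integer_mod_group)
  have "\<not> carrier G \<subseteq> {\<one>}"
    using card card_mono[of "{\<one>}" "carrier G"] by auto
  then obtain a where a: "a \<in> carrier G" "a \<noteq> \<one>" by auto
  have "\<not> carrier G \<subseteq> {\<one>, a}"
    using card card_mono[of "{\<one>, a}" "carrier G"] a by auto
  then obtain b where b: "b \<in> carrier G" "b \<noteq> \<one>" "b \<noteq> a" by auto
  have ba: "b \<otimes> a = a \<otimes> b" using exponent_two_commute[OF sq] a b by auto
  have ab1: "a \<otimes> b \<noteq> \<one>" using a b sq by (metis Units_l_cancel Units_eq)
  have aab: "a \<otimes> (a \<otimes> b) = b" using a b sq by (metis m_assoc l_one)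
  have abb: "b \<otimes> (a \<otimes> b) = a" using a b sq ba by (metis m_assoc r_one)
  define h :: "int \<times> int \<Rightarrow> 'a"
    where "h = (\<lambda>(i, j). (if i = 0 then \<one> else a) \<otimes> (if j = 0 then \<one> else b))"
  have "h \<in> hom ?V G"
    using a b ba aab abb sq[OF a(1)] sq[OF b(1)]
    by (intro homI) (auto simp: h_def c2 m_assoc)
  moreover have inj: "inj_on h (carrier ?V)"
    using a b ab1 by (auto simp: inj_on_def h_def c2)
  moreover have "h ` carrier ?V = carrier G"
  proof (rule card_subset_eq[OF fin])
    show "h ` carrier ?V \<subseteq> carrier G" using a b by (auto simp: h_def c2)
    show "card (h ` carrier ?V) = card (carrier G)"
      using card_image[OF inj] card by (simp add: c2)
  qed
  ultimately have "?V \<cong> G" by (intro is_isoI isoI) (auto simp: bij_betw_def)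
  thus ?thesis by (rule group.iso_sym[OF DirProd_group, rotated -1]) simp_all
qed

text \<open>
  This excludes the cyclic group when a product of two distinct nontrivial elements is an involution:
  if \<open>a \<otimes> a\<close> is not \<open>\<one>\<close>, it can only be \<open>c\<close>, and then \<open>(a \<otimes> c)\<^sup>2\<close> is the sixth power of \<open>a\<close>, which
  equals \<open>a \<otimes> a\<close> because \<open>a\<^sup>4 = \<one>\<close>.
\<close>

lemma (in group) order_four_square_eq_one:
  assumes card: "card (carrier G) = 4"
    and ac: "a \<in> carrier G" "c \<in> carrier G" "c \<noteq> \<one>" "a \<noteq> c"
    and ab: "a \<otimes> c \<noteq> \<one>" "a \<otimes> c \<otimes> (a \<otimes> c) = \<one>"
  shows "a \<otimes> a = \<one>"
proof (cases "a = \<one>")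
  case False
  have fin: "finite (carrier G)" using card by (metis card.infinite zero_neq_numeral)
  have d: "a \<otimes> c \<noteq> a" "a \<otimes> c \<noteq> c" using ac False by auto
  have "{\<one>, a, c, a \<otimes> c} = carrier G"
    using ac ab d False card by (intro card_subset_eq[OF fin]) auto
  moreover have "a \<otimes> a \<in> carrier G" using ac by simp
  ultimately consider "a \<otimes> a = \<one>" | "a \<otimes> a = a" | "a \<otimes> a = c" | "a \<otimes> a = a \<otimes> c"
    by blast
  thus ?thesis
  proof cases
    case 3
    have p4: "a \<otimes> a \<otimes> (a \<otimes> a) = \<one>"
      using pow_order_eq_1[OF ac(1)] card ac(1)
      by (simp add: order_def numeral_eq_Suc m_assoc)
    have "a \<otimes> a = (a \<otimes> a) \<otimes> (a \<otimes> a \<otimes> (a \<otimes> a))" using ac(1) p4 by simp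
    also have "\<dots> = a \<otimes> c \<otimes> (a \<otimes> c)" using ac(1) by (simp add: 3[symmetric] m_assoc)
    finally show ?thesis using ab(2) by simp
  qed (use ac in auto)
qed (simp)

lemma (in group) card_subgroup_dvd_card_subgroup:
  assumes "subgroup K G" "subgroup H G" "K \<subseteq> H"
  shows "card K dvd card H"
proof -
  interpret H: group "G\<lparr>carrier := H\<rparr>" by (rule subgroup_imp_group[OF assms(2)])
  show ?thesis
    using H.lagrange[OF subgroup_incl[OF assms]] by (auto simp: order_def intro: dvdI[of _ _ "card _"] dest: sym)
qed

section \<open>Counting\<close>

text \<open>
  Here \<open>S\<close> stands for the brace, \<open>Z\<close> for its annihilator and \<open>f a\<close> for the size of the centralizer of
  \<open>a\<close>. Write \<open>n\<close> for the index. Since a proper divisor is at most half, \<open>5 n\<^sup>2 \<le> 4 n (n + 1)\<close>, so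
  \<open>n \<le> 4\<close>; for \<open>n = 4\<close> this is an equality, so every \<open>f a\<close> off \<open>Z\<close> must be exactly half of \<open>|S|\<close>.
\<close>

lemma five_eighths_count:
  fixes f :: "'a \<Rightarrow> nat"
  assumes fin: "finite S" and Z: "Z \<subseteq> S" "Z \<noteq> {}" "card Z dvd card S"
    and full: "\<And>a. a \<in> Z \<Longrightarrow> f a = card S"
    and off: "\<And>a. a \<in> S - Z \<Longrightarrow> card Z dvd f a \<and> f a dvd card S \<and> f a \<noteq> card S"
    and total: "8 * sum f S = 5 * (card S)\<^sup>2"
  shows "card S = 4 * card Z \<and> (\<forall>a \<in> S - Z. f a = 2 * card Z)"
proof -
  define z where "z = card Z"
  have finZ: "finite Z" using fin Z finite_subset by auto
  have z: "z > 0" using Z finZ by (auto simp: z_def card_gt_0_iff)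
  obtain n where n: "card S = n * z" using Z(3) by (metis z_def dvd_def mult.commute)
  have n0: "n > 0" using n Z fin by (metis card_gt_0_iff gr0I mult_0 subset_empty)
  have cD: "card (S - Z) = (n - 1) * z"
    using card_Diff_subset[OF finZ Z(1)] n by (simp add: z_def diff_mult_distrib)
  have "sum f S = sum f (S - Z) + sum f Z" by (rule sum.subset_diff[OF Z(1) fin])
  hence tot: "sum f S = sum f (S - Z) + z * (n * z)"
    using full n by (simp add: z_def)
  have ex: "\<exists>k. f a = k * z \<and> k dvd n \<and> k < n \<and> k > 0" if aS: "a \<in> S - Z" for a
  proof -
    obtain k where k: "f a = k * z" using off[OF aS] by (metis z_def dvd_def mult.commute)
    have "k dvd n" using off[OF aS] k n z by simp
    moreover have "k \<noteq> n" using off[OF aS] k n by auto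
    ultimately show ?thesis using k n0 by (metis dvd_imp_le dvd_pos_nat le_neq_implies_less)
  qed
  have half: "2 * f a \<le> n * z" if aS: "a \<in> S - Z" for a
  proof -
    obtain k where k: "f a = k * z" "k dvd n" "k < n" "k > 0" using ex[OF aS] by blast
    then obtain q where q: "n = k * q" by (auto elim: dvdE)
    have "2 \<le> q" using q k by (cases q; cases "q - 1") auto
    hence "2 * k \<le> n" using q by (simp add: mult.commute)
    hence "2 * k * z \<le> n * z" by (intro mult_le_mono1)
    thus ?thesis using k by (simp add: mult.assoc)
  qed
  have "2 * sum f (S - Z) \<le> (n - 1) * z * (n * z)"
    using sum_bounded_above[of "S - Z" "\<lambda>a. 2 * f a" "n * z"] half cD
    by (simp add: sum_distrib_left)
  hence "5 * (n * z)\<^sup>2 \<le> 4 * ((n - 1) * z * (n * z)) + 8 * (z * (n * z))"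
    using total tot n by simp
  also have "\<dots> = (n * z * z) * (4 * n + 4)"
    using n0 by (cases n) (simp_all add: algebra_simps)
  finally have "(n * z * z) * (5 * n) \<le> (n * z * z) * (4 * n + 4)"
    by (simp add: algebra_simps power2_eq_square)
  hence n4: "n \<le> 4" using n0 z by simp
  \<comment> \<open>For a prime index the only proper divisor is 1, so the total is determined and is wrong.\<close>
  have one: "f a = z" if aS: "a \<in> S - Z" and n23: "n = 2 \<or> n = 3" for a
  proof -
    obtain k where k: "f a = k * z" "k dvd n" "k < n" "k > 0" using ex[OF aS] by blast
    have "k = 1"
    proof (rule ccontr)
      assume "k \<noteq> 1"
      hence "k = 2" "n = 3" using k n23 by auto
      thus False using k(2) by simp
    qed
    thus ?thesis using k by simp
  qed
  have small: False if "n = 2 \<or> n = 3"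
  proof -
    have "sum f (S - Z) = (n - 1) * z * z" using one[OF _ that] cD by simp
    thus False using that total tot n z by (auto simp: power2_eq_square)
  qed
  have "n \<noteq> 1"
  proof
    assume "n = 1"
    hence "S - Z = {}" using cD fin by auto
    thus False using \<open>n = 1\<close> total tot n z by (simp add: power2_eq_square del: Diff_eq_empty_iff)
  qed
  hence n: "n = 4" "card S = 4 * z" using n4 n0 small n by (auto simp: le_Suc_eq numeral_eq_Suc)
  have le: "f a \<le> 2 * z" if "a \<in> S - Z" for a using half[OF that] n by simp
  have "sum f (S - Z) = 3 * z * (2 * z)" using total tot n by (simp add: power2_eq_square)
  hence eq: "sum f (S - Z) = (\<Sum>a \<in> S - Z. 2 * z)" using cD n by simp
  have "f a = 2 * z" if "a \<in> S - Z" for a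
  proof (rule ccontr)
    assume "f a \<noteq> 2 * z"
    hence "f a < 2 * z" using le[OF that] by simp
    hence "sum f (S - Z) < (\<Sum>a \<in> S - Z. 2 * z)"
      using that le fin by (intro sum_strict_mono_ex1) auto
    thus False using eq by simp
  qed
  thus ?thesis using n by (simp add: z_def)
qed

section \<open>Centralizers in a skew brace\<close>

definition brace_centralizer :: "('a, 'm) ring_scheme \<Rightarrow> 'a \<Rightarrow> 'a set" where
  "brace_centralizer B a =
    {b \<in> carrier B. b \<oplus>\<^bsub>B\<^esub> a = a \<oplus>\<^bsub>B\<^esub> b \<and> a \<otimes>\<^bsub>B\<^esub> b = a \<oplus>\<^bsub>B\<^esub> b \<and> b \<otimes>\<^bsub>B\<^esub> a = a \<oplus>\<^bsub>B\<^esub> b}"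

context skew_left_brace
begin

interpretation A: group "add_monoid B"
  rewrites "carrier (add_monoid B) = carrier B"
    and "monoid.mult (add_monoid B) = (\<oplus>)"
    and "monoid.one (add_monoid B) = \<zero>"
    and "m_inv (add_monoid B) = a_inv B"
  by (simp_all add: add_group a_inv_def)

interpretation M: group B by (rule mult_group)

lemma centralizerD:
  assumes "b \<in> brace_centralizer B a"
  shows "b \<in> carrier B" "b \<oplus> a = a \<oplus> b" "a \<otimes> b = a \<oplus> b" "b \<otimes> a = a \<oplus> b"
  using assms by (auto simp: brace_centralizer_def)

lemma centralizer_sym:
  assumes "a \<in> carrier B" "b \<in> brace_centralizer B a"
  shows "a \<in> brace_centralizer B b"
  using assms by (auto simp: brace_centralizer_def)

lemma annihilator_iff_centralizer:
  "a \<in> brace_annihilator B \<longleftrightarrow> a \<in> carrier B \<and> brace_centralizer B a = carrier B"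
proof
  assume "a \<in> brace_annihilator B"
  thus "a \<in> carrier B \<and> brace_centralizer B a = carrier B"
    by (auto simp: brace_annihilator_def brace_centralizer_def)
next
  assume a: "a \<in> carrier B \<and> brace_centralizer B a = carrier B"
  show "a \<in> brace_annihilator B"
    by (rule annihilatorI) (use a centralizerD[of _ a] in auto)
qed

lemma annihilator_subset_centralizer:
  assumes "a \<in> carrier B"
  shows "brace_annihilator B \<subseteq> brace_centralizer B a"
  using assms by (auto simp: brace_annihilator_def brace_centralizer_def)

text \<open>
  The brace law turns sums with \<open>a\<close> into products: if \<open>b\<close> commutes with \<open>a\<close>, then
  \<open>b \<otimes> (a \<oplus> c) = a \<oplus> b \<ominus> b \<oplus> (b \<otimes> c) = a \<oplus> (b \<otimes> c)\<close>, so multiplication by \<open>b\<close> passes over the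
  summand \<open>a\<close> on either side. With \<open>c\<close> in the centralizer this gives closure under products, and with
  \<open>c = inv b\<close> closure under inverses.
\<close>

lemma centralizer_subgroup:
  assumes a: "a \<in> carrier B"
  shows "subgroup (brace_centralizer B a) B"
proof (rule M.subgroupI)
  let ?C = "brace_centralizer B a"
  show "?C \<subseteq> carrier B" by (auto simp: brace_centralizer_def)
  show "?C \<noteq> {}"
    using a annihilator_subset_centralizer[OF a] subgroup.one_closed[OF annihilator_add_subgroup]
    by auto
  have shift: "b \<otimes> (a \<oplus> c) = a \<oplus> (b \<otimes> c)" "b \<otimes> (c \<oplus> a) = (b \<otimes> c) \<oplus> a"
    if b: "b \<in> ?C" and c: "c \<in> carrier B" for b c
  proof -
    note bD = centralizerD[OF b]
    have "b \<otimes> (a \<oplus> c) = a \<oplus> (b \<oplus> \<ominus> b) \<oplus> (b \<otimes> c)"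
      using brace_distrib[of b a c] bD a c by (simp only: a_minus_def A.m_assoc A.inv_closed)
    thus "b \<otimes> (a \<oplus> c) = a \<oplus> (b \<otimes> c)" using bD(1) a by simp
    have "b \<otimes> (c \<oplus> a) = (b \<otimes> c) \<oplus> \<ominus> b \<oplus> (b \<oplus> a)"
      using brace_distrib[of b c a] bD a c by (simp add: a_minus_def)
    also have "\<dots> = (b \<otimes> c) \<oplus> ((\<ominus> b \<oplus> b) \<oplus> a)"
      using bD(1) a c by (simp only: A.m_assoc A.inv_closed M.m_closed A.m_closed)
    finally show "b \<otimes> (c \<oplus> a) = (b \<otimes> c) \<oplus> a" using bD(1) a c by simp
  qed
  fix b assume b: "b \<in> ?C"
  note bD = centralizerD[OF b]
  have 1: "b \<otimes> (a \<oplus> inv b) = a" "b \<otimes> (inv b \<oplus> a) = a"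
    using shift[OF b, of "inv b"] bD a by (simp_all add: zero_eq_one[symmetric])
  hence 2: "a \<oplus> inv b = inv b \<otimes> a" "inv b \<oplus> a = inv b \<otimes> a"
    using bD(1) a by (metis A.m_closed M.inv_closed M.inv_solve_left)+
  have "a \<otimes> b = b \<otimes> a" using bD by simp
  hence "b \<otimes> (a \<otimes> inv b) = a"
    using bD(1) a by (metis M.inv_closed M.m_assoc M.r_inv M.r_one)
  hence "a \<otimes> inv b = inv b \<otimes> a"
    using bD(1) a by (metis M.m_closed M.inv_closed M.inv_solve_left)
  thus "inv b \<in> ?C" using 2 bD by (auto simp: brace_centralizer_def)
  fix c assume c: "c \<in> ?C"
  note cD = centralizerD[OF c]
  have "(b \<otimes> c) \<otimes> a = a \<oplus> (b \<otimes> c)" "(b \<otimes> c) \<oplus> a = a \<oplus> (b \<otimes> c)"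
    using shift[OF b cD(1)] bD cD a by (auto simp: M.m_assoc)
  moreover have "a \<otimes> (b \<otimes> c) = b \<otimes> (c \<otimes> a)"
    using bD cD a by (metis M.m_assoc)
  ultimately show "b \<otimes> c \<in> ?C"
    using bD cD a by (auto simp: brace_centralizer_def M.m_assoc)
qed

lemma annihilator_mult_subgroup: "subgroup (brace_annihilator B) B"
proof -
  have "brace_annihilator B = \<Inter> (brace_centralizer B ` carrier B)"
    using M.one_closed by (auto simp: brace_annihilator_def brace_centralizer_def)
  thus ?thesis using M.subgroups_Inter[of "brace_centralizer B ` carrier B"] centralizer_subgroup
    by auto
qed

text \<open>This identifies the pairs counted by the commuting probability.\<close>

lemma centralizer_iff:
  assumes a: "a \<in> carrier B" and b: "b \<in> carrier B"
  shows "b \<in> brace_centralizer B a \<longleftrightarrow>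
    brace_star B a b = \<zero> \<and> brace_star B b a = \<zero> \<and> add_commutator B a b = \<zero>"
proof -
  have d: "x \<ominus> y = \<zero> \<longleftrightarrow> x = y" if "x \<in> carrier B" "y \<in> carrier B" for x y
  proof -
    have "x = (x \<ominus> y) \<oplus> y" using that by (simp add: a_minus_def A.m_assoc)
    thus ?thesis using that by (metis A.l_one A.r_inv a_minus_def)
  qed
  have star: "brace_star B x y = \<zero> \<longleftrightarrow> x \<otimes> y = x \<oplus> y"
    if x: "x \<in> carrier B" and y: "y \<in> carrier B" for x y
  proof -
    have "brace_star B x y = \<zero> \<longleftrightarrow> (\<ominus> x) \<oplus> (x \<otimes> y) = y"
      using d x y by (simp add: brace_star_def)
    also have "\<dots> \<longleftrightarrow> x \<otimes> y = x \<oplus> y"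
      by (rule A.inv_solve_left'[OF y x M.m_closed[OF x y]])
    finally show ?thesis .
  qed
  have "add_commutator B a b = \<zero> \<longleftrightarrow> (a \<oplus> b) \<ominus> a = b"
    using d a b by (simp add: add_commutator_def a_minus_def)
  also have "\<dots> \<longleftrightarrow> a \<oplus> b = b \<oplus> a"
    unfolding a_minus_def by (rule A.inv_solve_right'[OF b A.m_closed[OF a b] a])
  finally show ?thesis
    using star[OF a b] star[OF b a] b by (auto simp: brace_centralizer_def)
qed

lemma commuting_probability_eq_sum:
  assumes "finite (carrier B)"
  shows "commuting_probability B =
    real (\<Sum>a \<in> carrier B. card (brace_centralizer B a)) / (real (card (carrier B)))\<^sup>2"
proof -
  have "{(a, b). a \<in> carrier B \<and> b \<in> carrier B \<and> brace_star B a b = \<zero> \<and>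
      brace_star B b a = \<zero> \<and> add_commutator B a b = \<zero>} =
      (SIGMA a : carrier B. brace_centralizer B a)"
    using centralizer_iff by (auto dest: centralizerD(1))
  moreover have "\<forall>a \<in> carrier B. finite (brace_centralizer B a)"
    using assms by (auto simp: brace_centralizer_def)
  ultimately show ?thesis
    using assms by (simp add: commuting_probability_def card_SigmaI)
qed

lemma five_eighths_structure:
  assumes fin: "finite (carrier B)" and pb: "commuting_probability B = 5 / 8"
  shows "card (carrier B) = 4 * card (brace_annihilator B)"
    and "\<And>a. a \<in> carrier B - brace_annihilator B \<Longrightarrow>
      card (brace_centralizer B a) = 2 * card (brace_annihilator B)"
proof -
  let ?S = "carrier B" and ?Z = "brace_annihilator B" and ?f = "\<lambda>a. card (brace_centralizer B a)"
  have ne: "?Z \<noteq> {}" using subgroup.one_closed[OF annihilator_mult_subgroup] by auto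
  have dvd: "card H dvd card ?S" if "subgroup H B" for H
    using M.card_subgroup_dvd_card_subgroup[OF that M.subgroup_self] subgroup.subset[OF that]
    by simp
  have "card ?S > 0" using fin M.one_closed by (auto simp: card_gt_0_iff)
  hence "8 * real (sum ?f ?S) = real (5 * (card ?S)\<^sup>2)"
    using pb unfolding commuting_probability_eq_sum[OF fin] by (simp add: field_simps)
  hence total: "8 * sum ?f ?S = 5 * (card ?S)\<^sup>2" by linarith
  have "card ?S = 4 * card ?Z \<and> (\<forall>a \<in> ?S - ?Z. ?f a = 2 * card ?Z)"
  proof (rule five_eighths_count[OF fin _ ne dvd[OF annihilator_mult_subgroup] _ _ total])
    show "?Z \<subseteq> ?S" by (auto simp: brace_annihilator_def)
    show "?f a = card ?S" if "a \<in> ?Z" for a using that by (simp add: annihilator_iff_centralizer)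
    fix a assume a: "a \<in> ?S - ?Z"
    have "brace_centralizer B a \<subseteq> ?S" by (auto simp: brace_centralizer_def)
    moreover have "brace_centralizer B a \<noteq> ?S" using a by (auto simp: annihilator_iff_centralizer)
    ultimately have "?f a \<noteq> card ?S" using card_subset_eq[OF fin] by blast
    thus "card ?Z dvd ?f a \<and> ?f a dvd card ?S \<and> ?f a \<noteq> card ?S"
      using a dvd[OF centralizer_subgroup] M.card_subgroup_dvd_card_subgroup
        annihilator_mult_subgroup centralizer_subgroup annihilator_subset_centralizer by auto
  qed
  thus "card ?S = 4 * card ?Z" "\<And>a. a \<in> ?S - ?Z \<Longrightarrow> ?f a = 2 * card ?Z" by auto
qed

section \<open>The quotient by the annihilator\<close>

lemma annihilator_coset_eq_iff:
  assumes "x \<in> carrier B" "y \<in> carrier B"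
  shows "brace_annihilator B +> x = brace_annihilator B +> y \<longleftrightarrow> x \<in> brace_annihilator B +> y"
proof
  assume "x \<in> brace_annihilator B +> y"
  thus "brace_annihilator B +> x = brace_annihilator B +> y"
    using annihilator_coset_eq assms by (auto simp: annihilator_coset_iff)
next
  assume "brace_annihilator B +> x = brace_annihilator B +> y"
  moreover have "x \<in> brace_annihilator B +> x"
    using assms subgroup.one_closed[OF annihilator_add_subgroup]
    by (auto simp: annihilator_coset_iff intro!: bexI[of _ \<zero>])
  ultimately show "x \<in> brace_annihilator B +> y" by simp
qed

lemma quot_zero: "\<zero>\<^bsub>B Quot brace_annihilator B\<^esub> = brace_annihilator B +> \<zero>"
  and quot_one: "\<one>\<^bsub>B Quot brace_annihilator B\<^esub> = brace_annihilator B +> \<zero>"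
  using A.coset_mult_one[of "brace_annihilator B"]
  by (auto simp: FactRing_def a_r_coset_def brace_annihilator_def zero_eq_one)

lemma annihilator_coset_eq_zero_iff:
  assumes "x \<in> carrier B"
  shows "brace_annihilator B +> x = brace_annihilator B +> \<zero> \<longleftrightarrow> x \<in> brace_annihilator B"
  using annihilator_coset_eq_iff[OF assms A.one_closed]
  by (auto simp: annihilator_coset_iff) (auto simp: brace_annihilator_def)

lemma card_annihilator_coset:
  assumes "x \<in> carrier B"
  shows "card (brace_annihilator B +> x) = card (brace_annihilator B)"
proof -
  have "brace_annihilator B +> x = (\<lambda>i. i \<oplus> x) ` brace_annihilator B"
    using assms by (auto simp: annihilator_coset_iff)
  moreover have "inj_on (\<lambda>i. i \<oplus> x) (brace_annihilator B)"
    using assms by (auto simp: inj_on_def brace_annihilator_def)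
  ultimately show ?thesis by (simp add: card_image)
qed

lemma card_quot:
  "card (carrier (B Quot brace_annihilator B)) * card (brace_annihilator B) = card (carrier B)"
  using A.lagrange[OF annihilator_add_subgroup]
  by (simp add: FactRing_def A_RCOSETS_def order_def)

context
  assumes fin: "finite (carrier B)" and pb: "commuting_probability B = 5 / 8"
begin

lemma card_annihilator_pos: "card (brace_annihilator B) > 0"
proof -
  have "finite (brace_annihilator B)" using fin by (auto simp: brace_annihilator_def)
  thus ?thesis
    using subgroup.one_closed[OF annihilator_mult_subgroup] by (auto simp: card_gt_0_iff)
qed

text \<open>
  The centralizer is the union of only two cosets of the annihilator, so any element of it outside the
  annihilator represents the second one.
\<close>

lemma five_eighths_centralizer:
  assumes a: "a \<in> carrier B" "a \<notin> brace_annihilator B"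
    and c: "c \<in> brace_centralizer B a" "c \<notin> brace_annihilator B"
  shows "brace_centralizer B a = brace_annihilator B \<union> (brace_annihilator B +> c)"
proof -
  let ?Z = "brace_annihilator B" and ?C = "brace_centralizer B a"
  have finC: "finite ?C" using fin by (auto simp: brace_centralizer_def)
  have ZC: "?Z \<subseteq> ?C" by (rule annihilator_subset_centralizer[OF a(1)])
  have finZ: "finite ?Z" using finC ZC finite_subset by auto
  have cc: "c \<in> carrier B" using centralizerD(1)[OF c(1)] .
  have disj: "?Z \<inter> (?Z +> c) = {}"
  proof (rule ccontr)
    assume "?Z \<inter> (?Z +> c) \<noteq> {}"
    then obtain x where x: "x \<in> ?Z" "x \<in> ?Z +> c" by auto
    have xc: "x \<in> carrier B" using x by (auto simp: brace_annihilator_def)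
    show False
      using annihilator_coset_eq_iff[OF xc cc] annihilator_coset_eq_zero_iff[OF xc]
        annihilator_coset_eq_zero_iff[OF cc] x c by auto
  qed
  have sub: "?Z +> c \<subseteq> ?C"
    using c ZC subgroup.m_closed[OF centralizer_subgroup[OF a(1)]] annihilatorD(3)[OF _ cc]
    by (fastforce simp: annihilator_coset_iff[OF cc])
  have "card (?Z \<union> (?Z +> c)) = 2 * card ?Z"
    using card_Un_disjoint[OF finZ _ disj] finite_subset[OF sub finC] card_annihilator_coset[OF cc]
    by simp
  hence "?Z \<union> (?Z +> c) = ?C"
    using five_eighths_structure(2)[OF fin pb, of a] a sub ZC
    by (intro card_subset_eq[OF finC]) auto
  thus ?thesis by simp
qed

lemma five_eighths_partner:
  assumes a: "a \<in> carrier B" "a \<notin> brace_annihilator B"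
  obtains c where "c \<in> brace_centralizer B a" "c \<notin> brace_annihilator B"
proof -
  let ?Z = "brace_annihilator B" and ?C = "brace_centralizer B a"
  have "?C \<noteq> ?Z" using card_annihilator_pos five_eighths_structure(2)[OF fin pb, of a] a by auto
  thus ?thesis using that annihilator_subset_centralizer[OF a(1)] by auto
qed

text \<open>
  For \<open>a\<close> outside the annihilator \<open>Z\<close>, let \<open>c\<close>, also outside \<open>Z\<close>, commute with \<open>a\<close>. Symmetry puts \<open>a\<close> into the subgroup \<open>C(c) = Z \<union> (Z +> a)\<close>, so \<open>a \<otimes> a\<close> lies in
  one of these two cosets; the second would force \<open>a \<in> Z\<close>.
\<close>

lemma five_eighths_mult_square:
  assumes a: "a \<in> carrier B"
  shows "a \<otimes> a \<in> brace_annihilator B"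
proof (cases "a \<in> brace_annihilator B")
  case True
  thus ?thesis using subgroup.m_closed[OF annihilator_mult_subgroup] by blast
next
  case False
  let ?Z = "brace_annihilator B"
  obtain c where c: "c \<in> brace_centralizer B a" "c \<notin> ?Z"
    using five_eighths_partner[OF a False] .
  have cc: "c \<in> carrier B" using centralizerD(1)[OF c(1)] .
  have aC: "a \<in> brace_centralizer B c" using centralizer_sym[OF a c(1)] .
  have Cc: "brace_centralizer B c = ?Z \<union> (?Z +> a)"
    using five_eighths_centralizer[OF cc c(2) aC False] .
  have "a \<otimes> a \<in> brace_centralizer B c"
    using subgroup.m_closed[OF centralizer_subgroup[OF cc] aC aC] .
  moreover have "a \<otimes> a \<notin> ?Z +> a"
  proof
    assume "a \<otimes> a \<in> ?Z +> a"
    then obtain i where i: "i \<in> ?Z" "a \<otimes> a = i \<oplus> a" using annihilator_coset_iff[OF a] by auto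
    hence "a \<otimes> a = i \<otimes> a" using annihilatorD(3)[OF i(1) a] by simp
    hence "a = i" using a i(1) annihilatorD(1)[OF i(1) a] by simp
    thus False using i False by simp
  qed
  ultimately show ?thesis using Cc by auto
qed

lemma quot_card_four: "card (carrier (B Quot brace_annihilator B)) = 4"
proof -
  show ?thesis using card_annihilator_pos card_quot five_eighths_structure(1)[OF fin pb] by simp
qed

text \<open>
  The additive structure is reached through commuting pairs, where sum and product coincide. An element
  commuting with itself inherits \<open>x \<oplus> x \<in> Z\<close> from the multiplicative case; otherwise the partner
  of \<open>a\<close> is a different class and the remaining class commutes with itself.
\<close>

lemma five_eighths_add_square:
  assumes a: "a \<in> carrier B"
  shows "a \<oplus> a \<in> brace_annihilator B"
proof -
  let ?Z = "brace_annihilator B" and ?Q = "B Quot brace_annihilator B"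
  have self: "x \<oplus> x \<in> ?Z" if "x \<in> brace_centralizer B x" for x
    using five_eighths_mult_square centralizerD[OF that] by metis
  show ?thesis
  proof (cases "a \<in> ?Z")
    case True
    thus ?thesis using subgroup.m_closed[OF annihilator_add_subgroup] by auto
  next
    case False
    obtain c where c: "c \<in> brace_centralizer B a" "c \<notin> ?Z"
      using five_eighths_partner[OF a False] .
    have cc: "c \<in> carrier B" using centralizerD(1)[OF c(1)] .
    have Ca: "brace_centralizer B a = ?Z \<union> (?Z +> c)"
      using five_eighths_centralizer[OF a False c] .
    have Cc: "brace_centralizer B c = ?Z \<union> (?Z +> a)"
      using five_eighths_centralizer[OF cc c(2) centralizer_sym[OF a c(1)] False] .
    show ?thesis
    proof (cases "?Z +> a = ?Z +> c")
      case True
      thus ?thesis using self Ca annihilator_coset_eq_iff[OF a cc] by auto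
    next
      case neq: False
      define d where "d = a \<oplus> c"
      have dc: "d \<in> carrier B" using a cc by (simp add: d_def)
      interpret QM: group ?Q by (rule quot_mult_group)
      interpret QA: group "add_monoid ?Q" by (rule quot_add_group)
      have coset: "?Z +> x \<in> carrier ?Q" if "x \<in> carrier B" for x using that by (auto simp: quot_carrier)
      \<comment> \<open>Modulo \<open>Z\<close> also \<open>d = a \<otimes> c\<close> with \<open>a \<otimes> a = \<one>\<close>, so cancelling shows that the class of \<open>d\<close> is new.\<close>
      have dm: "?Z +> d = (?Z +> a) \<otimes>\<^bsub>?Q\<^esub> (?Z +> c)"
        using a cc centralizerD(3)[OF c(1)] by (simp add: quot_mult d_def)
      have sq: "(?Z +> x) \<otimes>\<^bsub>?Q\<^esub> (?Z +> x) = \<one>\<^bsub>?Q\<^esub>" if "x \<in> carrier B" for x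
        using that five_eighths_mult_square[OF that] annihilator_coset_eq_zero_iff[of "x \<otimes> x"]
        by (simp add: quot_mult quot_one)
      have d1: "?Z +> d \<noteq> ?Z +> \<zero>"
      proof
        assume "?Z +> d = ?Z +> \<zero>"
        hence "(?Z +> a) \<otimes>\<^bsub>?Q\<^esub> (?Z +> c) = (?Z +> a) \<otimes>\<^bsub>?Q\<^esub> (?Z +> a)"
          using dm sq[OF a] quot_one by simp
        thus False using QM.Units_l_cancel coset[OF a] coset[OF cc] neq by (simp add: QM.Units_eq)
      qed
      have da: "?Z +> d \<noteq> ?Z +> a"
        using dm coset[OF a] coset[OF cc] c(2) annihilator_coset_eq_zero_iff[OF cc] quot_one
        by (simp add: QM.l_cancel_one)
      have dC: "?Z +> d \<noteq> ?Z +> c"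
        using dm coset[OF a] coset[OF cc] False annihilator_coset_eq_zero_iff[OF a] quot_one
        by (simp add: QM.r_cancel_one)
      have dZ: "d \<notin> ?Z" using d1 annihilator_coset_eq_zero_iff[OF dc] by simp
      have a1: "?Z +> a \<noteq> ?Z +> \<zero>" using annihilator_coset_eq_zero_iff[OF a] False by simp
      have c1: "?Z +> c \<noteq> ?Z +> \<zero>" using annihilator_coset_eq_zero_iff[OF cc] c by simp
      have "finite (carrier ?Q)" using fin by (simp add: quot_carrier)
      moreover have "{?Z +> \<zero>, ?Z +> a, ?Z +> c, ?Z +> d} \<subseteq> carrier ?Q"
        using coset a cc dc by simp
      moreover have "card {?Z +> \<zero>, ?Z +> a, ?Z +> c, ?Z +> d} = card (carrier ?Q)"
        using a1 c1 d1 da dC neq quot_card_four by simp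
      ultimately have Q: "{?Z +> \<zero>, ?Z +> a, ?Z +> c, ?Z +> d} = carrier ?Q"
        by (rule card_subset_eq)
      obtain e where e: "e \<in> brace_centralizer B d" "e \<notin> ?Z"
        using five_eighths_partner[OF dc dZ] .
      have ec: "e \<in> carrier B" using centralizerD(1)[OF e(1)] .
      have Cd: "brace_centralizer B d = ?Z \<union> (?Z +> e)"
        using five_eighths_centralizer[OF dc dZ e] .
      \<comment> \<open>The classes of \<open>a\<close> and \<open>c\<close> are each other's partners, so neither is left for \<open>d\<close>.\<close>
      have outside: "?Z +> e \<noteq> ?Z +> u"
        if u: "u \<in> carrier B" "d \<notin> brace_centralizer B u" for u
      proof
        assume "?Z +> e = ?Z +> u"
        hence "u \<in> brace_centralizer B d" using annihilator_coset_eq_iff[OF u(1) ec] Cd by simp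
        thus False using centralizer_sym[OF dc] u by blast
      qed
      have "?Z +> e \<noteq> ?Z +> a" "?Z +> e \<noteq> ?Z +> c"
        using outside[OF a] outside[OF cc] Ca Cc dZ da dC
          annihilator_coset_eq_iff[OF dc a] annihilator_coset_eq_iff[OF dc cc] by auto
      moreover have "?Z +> e \<noteq> ?Z +> \<zero>" using e annihilator_coset_eq_zero_iff[OF ec] by simp
      moreover have "?Z +> e \<in> {?Z +> \<zero>, ?Z +> a, ?Z +> c, ?Z +> d}"
        unfolding Q by (rule coset[OF ec])
      ultimately have "?Z +> e = ?Z +> d" by blast
      hence "d \<in> brace_centralizer B d" using annihilator_coset_eq_iff[OF dc ec] Cd by simp
      hence dd: "d \<oplus> d \<in> ?Z" by (rule self)
      have "(?Z +> a) \<otimes>\<^bsub>add_monoid ?Q\<^esub> (?Z +> a) = \<one>\<^bsub>add_monoid ?Q\<^esub>"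
      proof (rule QA.order_four_square_eq_one[of _ "?Z +> c"])
        show "(?Z +> a) \<otimes>\<^bsub>add_monoid ?Q\<^esub> (?Z +> c) \<otimes>\<^bsub>add_monoid ?Q\<^esub>
            ((?Z +> a) \<otimes>\<^bsub>add_monoid ?Q\<^esub> (?Z +> c)) = \<one>\<^bsub>add_monoid ?Q\<^esub>"
          using a cc dc dd annihilator_coset_eq_zero_iff[of "d \<oplus> d"]
          by (simp add: quot_add quot_zero d_def)
        show "(?Z +> a) \<otimes>\<^bsub>add_monoid ?Q\<^esub> (?Z +> c) \<noteq> \<one>\<^bsub>add_monoid ?Q\<^esub>"
          using a cc d1 by (simp add: quot_add quot_zero d_def)
      qed (use quot_card_four coset a cc c1 neq in \<open>auto simp: quot_zero\<close>)
      thus ?thesis using a annihilator_coset_eq_zero_iff[of "a \<oplus> a"]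
        by (simp add: quot_add quot_zero)
    qed
  qed
qed

end

end

theorem theorem3p10:
  fixes B :: "('a, 'm) ring_scheme"
  assumes "skew_left_brace B"
    and "finite (carrier B)"
    and "commuting_probability B = 5 / 8"
  shows "add_monoid (B Quot brace_annihilator B) \<cong> integer_mod_group 2 \<times>\<times> integer_mod_group 2 \<and>
    (B Quot brace_annihilator B) \<cong> integer_mod_group 2 \<times>\<times> integer_mod_group 2"
proof -
  interpret skew_left_brace B by (rule assms(1))
  let ?Z = "brace_annihilator B" and ?Q = "B Quot brace_annihilator B"
  have zero: "?Z +>\<^bsub>B\<^esub> x = ?Z +>\<^bsub>B\<^esub> \<zero>\<^bsub>B\<^esub>" if "x \<in> ?Z" for x
    using that annihilator_coset_eq_zero_iff[of x] by (auto simp: brace_annihilator_def)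
  have "X \<oplus>\<^bsub>?Q\<^esub> X = \<zero>\<^bsub>?Q\<^esub>" if X: "X \<in> carrier ?Q" for X
  proof -
    obtain x where x: "x \<in> carrier B" "X = ?Z +>\<^bsub>B\<^esub> x" using X by (auto simp: quot_carrier)
    show ?thesis
      using zero[OF five_eighths_add_square[OF assms(2,3) x(1)]] x
      by (simp add: quot_add quot_zero)
  qed
  hence "add_monoid ?Q \<cong> integer_mod_group 2 \<times>\<times> integer_mod_group 2"
    using quot_card_four[OF assms(2,3)]
    by (intro group.order_four_exponent_two_iso quot_add_group) auto
  moreover have "X \<otimes>\<^bsub>?Q\<^esub> X = \<one>\<^bsub>?Q\<^esub>" if X: "X \<in> carrier ?Q" for X
  proof -
    obtain x where x: "x \<in> carrier B" "X = ?Z +>\<^bsub>B\<^esub> x" using X by (auto simp: quot_carrier)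
    show ?thesis
      using zero[OF five_eighths_mult_square[OF assms(2,3) x(1)]] x
      by (simp add: quot_mult quot_one)
  qed
  hence "?Q \<cong> integer_mod_group 2 \<times>\<times> integer_mod_group 2"
    using quot_card_four[OF assms(2,3)]
    by (intro group.order_four_exponent_two_iso quot_mult_group) auto
  ultimately show ?thesis by blast
qed

end
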